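(* Let $G=(V,E,\mathcal{K})$ be a finite undirected graph with terminal set $\mathcal{K}\subseteq V$, and let $P=(p_e)_{e\in E}$ be edge failure probabilities with $p_e\in(0,1)$ such that each $1-p_e$ has a finite binary representation $1-p_e=0.b^{(e)}_1\cdots b^{(e)}_{m_e}$. Construct $G'=(V',E',\mathcal{K})$ by replacing each edge $e\in E$ with end vertices $u,v$ by the series-parallel gadget $G^e$ described in the context (identifying its terminals $v_0$ and $v_{z_{m_e}+1}$ with $u$ and $v$), let $M=\sum_{e\in E}m_e=|E'|$, and let $F_{\mathcal{K}}$ be the formula described in the context built from $G'$. Then $$u_G(P)=\frac{\#F_{\mathcal{K}}}{2^M}.$$
   Context: Unreliability $u_G(P)$: each edge $e$ fails independently with probability $p_e$; $u_G(P)$ is the probability that not all vertices of $\mathcal{K}$ lie in one connected component of the subgraph of working edges. Gadget $G^e$: for $q=1-p_e=0.b_1\cdots b_{m}$ (with $m=m_e$), let $z_k=k-\sum_{i=1}^k b_i$ for $k=0,\dots,m$ (so $z_0=0$), vertices $v_0,\dots,v_{z_m+1}$ (with $v_1,\dots,v_{z_m}$ new vertices private to $G^e$), and $m$ edges $e_1,\dots,e_m$ where $e_k$ joins $v_{z_{k-1}}$ and $v_{z_k}$ if $b_k=0$, and joins $v_{z_{k-1}}$ and $v_{z_m+1}$ if $b_k=1$ (parallel edges allowed). Thus $G'$ may have parallel edges, each treated as a separate edge. Formula: with propositional variables $s_u$ for $u\in V'$ and $x_e$ for $e\in E'$, for each edge $e\in E'$ with end vertices $u,v$ let $C_e=[(s_u\wedge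 x_e)\rightarrow s_v]\wedge[(s_v\wedge x_e)\rightarrow s_u]$, and $F_{\mathcal{K}}=\exists S\big[\big(\bigvee_{j\in\mathcal{K}}s_j\big)\wedge\big(\bigvee_{k\in\mathcal{K}}\neg s_k\big)\wedge\bigwedge_{e\in E'}C_e\big]$, where $S=(s_u)_{u\in V'}$. $\#F_{\mathcal{K}}$ is the number of assignments $X\in\{0,1\}^{|E'|}$ of the edge variables for which some assignment of $S$ satisfies the quantifier-free part. *)

theory Defs
  imports "HOL-Probability.Probability"
begin

text \<open>Undirected graphs with terminals. Edges are named objects, so parallel edges are distinct;
  a loop is an edge whose set of ends is a singleton.\<close>

record ('v, 'e) graph =
  verts :: "'v set"
  edges :: "'e set"
  ends :: "'e \<Rightarrow> 'v set"
  terminals :: "'v set"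

definition finite_graph :: "('v, 'e) graph \<Rightarrow> bool" where
  "finite_graph G \<longleftrightarrow>
     finite (verts G) \<and> finite (edges G) \<and> terminals G \<subseteq> verts G \<and>
     (\<forall>e\<in>edges G. \<exists>u\<in>verts G. \<exists>v\<in>verts G. ends G e = {u, v})"

definition connection :: "('v, 'e) graph \<Rightarrow> 'e set \<Rightarrow> ('v \<times> 'v) set" where
  "connection G W =
     {(u, v). u \<in> verts G \<and> v \<in> verts G \<and> (u, v) \<in> {(x, y). \<exists>e\<in>W. ends G e = {x, y}}\<^sup>*}"

definition components :: "('v, 'e) graph \<Rightarrow> 'e set \<Rightarrow> 'v set set" where
  "components G W = verts G // connection G W"

text \<open>The first disjunct only matters for the graph without vertices, which has no components.\<close>

definition terminals_connected :: "('v, 'e) graph \<Rightarrow> 'e set \<Rightarrow> bool" where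
  "terminals_connected G W \<longleftrightarrow>
     terminals G = {} \<or> (\<exists>C\<in>components G W. terminals G \<subseteq> C)"

text \<open>In a state \<open>w\<close> drawn from the product distribution, \<open>w e\<close> says that edge \<open>e\<close> works.\<close>

definition unreliability :: "('v, 'e) graph \<Rightarrow> ('e \<Rightarrow> real) \<Rightarrow> real" where
  "unreliability G p =
     measure_pmf.prob (Pi_pmf (edges G) False (\<lambda>e. bernoulli_pmf (1 - p e)))
       {w. \<not> terminals_connected G {e \<in> edges G. w e}}"

text \<open>Digit sequences \<open>b\<close> are indexed from 1; as digits are 0 or 1, the subtraction does not truncate.\<close>

definition zeros :: "(nat \<Rightarrow> nat) \<Rightarrow> nat \<Rightarrow> nat" where
  "zeros b k = k - (\<Sum>i=1..k. b i)"

datatype ('v, 'e) gadget_vertex = Orig 'v | New 'e nat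

text \<open>The vertex \<open>v\<^sub>i\<close> of the gadget that replaces an edge \<open>e\<close> with ends \<open>u\<close> and \<open>v\<close>, where \<open>n\<close> is
  the number of zeros among all the digits.\<close>

definition gadget_vert :: "'e \<Rightarrow> 'v \<Rightarrow> 'v \<Rightarrow> nat \<Rightarrow> nat \<Rightarrow> ('v, 'e) gadget_vertex" where
  "gadget_vert e u v n i = (if i = 0 then Orig u else if i = n + 1 then Orig v else New e i)"

definition gadget_ends ::
    "'e \<Rightarrow> 'v \<Rightarrow> 'v \<Rightarrow> nat \<Rightarrow> (nat \<Rightarrow> nat) \<Rightarrow> nat \<Rightarrow> ('v, 'e) gadget_vertex set" where
  "gadget_ends e u v m b k =
     (let vert = gadget_vert e u v (zeros b m)
      in {vert (zeros b (k - 1)), if b k = 0 then vert (zeros b k) else vert (zeros b m + 1)})"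

text \<open>\<open>src\<close> and \<open>tgt\<close> fix which end of each edge is identified with the first and which with the
  last vertex of its gadget.\<close>

definition gadget_graph ::
    "('v, 'e) graph \<Rightarrow> ('e \<Rightarrow> 'v) \<Rightarrow> ('e \<Rightarrow> 'v) \<Rightarrow> ('e \<Rightarrow> nat) \<Rightarrow> ('e \<Rightarrow> nat \<Rightarrow> nat) \<Rightarrow>
      (('v, 'e) gadget_vertex, 'e \<times> nat) graph" where
  "gadget_graph G src tgt m b =
     \<lparr>verts = Orig ` verts G \<union> {New e i |e i. e \<in> edges G \<and> i \<in> {1..zeros (b e) (m e)}},
      edges = (SIGMA e:edges G. {1..m e}),
      ends = (\<lambda>(e, k). gadget_ends e (src e) (tgt e) (m e) (b e) k),
      terminals = Orig ` terminals G\<rparr>"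

definition clause :: "('v, 'e) graph \<Rightarrow> ('v \<Rightarrow> bool) \<Rightarrow> ('e \<Rightarrow> bool) \<Rightarrow> 'e \<Rightarrow> bool" where
  "clause G s x e \<longleftrightarrow>
     (\<forall>u v. ends G e = {u, v} \<longrightarrow> ((s u \<and> x e) \<longrightarrow> s v) \<and> ((s v \<and> x e) \<longrightarrow> s u))"

definition formula :: "('v, 'e) graph \<Rightarrow> ('e \<Rightarrow> bool) \<Rightarrow> bool" where
  "formula G x \<longleftrightarrow>
     (\<exists>s \<in> verts G \<rightarrow>\<^sub>E UNIV.
        (\<exists>j\<in>terminals G. s j) \<and> (\<exists>k\<in>terminals G. \<not> s k) \<and> (\<forall>e\<in>edges G. clause G s x e))"

definition model_count :: "('v, 'e) graph \<Rightarrow> nat" where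
  "model_count G = card {x \<in> edges G \<rightarrow>\<^sub>E UNIV. formula G x}"

end

theory Submission
  imports Defs
begin

text \<open>Both sides count two-colourings of the vertices that separate the terminals and are constant
  along working edges. Such a colouring of \<open>G\<close> extends over a gadget unless the gadget joins its two
  terminal vertices while these have different colours. For a gadget with digits
  \<open>b\<^sub>1, \<dots>, b\<^sub>m\<close> and states \<open>y\<^sub>1, \<dots>, y\<^sub>m\<close> of its edges, the terminal vertices are joined iff the binary number
  with digits \<open>1 - y\<^sub>k\<close> is less than the one with digits \<open>b\<^sub>k\<close>, so a fraction
  \<open>0.b\<^sub>1\<dots>b\<^sub>m = 1 - p\<^sub>e\<close> of all states joins them. Summing over the states of \<open>G\<close> induced by
  the states of the gadgets gives the theorem.\<close>

section \<open>Separating colourings and connectivity of the terminals\<close>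

text \<open>\<open>clause\<close> ranges over both namings of the two ends, but its pair of
  implications is symmetric in them, so a single naming decides it.\<close>

lemma clause_iff:
  assumes "ends G e = {u, v}"
  shows "clause G s x e \<longleftrightarrow> (x e \<longrightarrow> s u = s v)"
  using assms by (auto simp: clause_def doubleton_eq_iff)

lemma formulaE:
  assumes "formula G x"
  obtains s j k where "j \<in> terminals G" "s j" "k \<in> terminals G" "\<not> s k"
    "\<forall>e\<in>edges G. clause G s x e"
  using assms unfolding formula_def by (elim bexE conjE)

text \<open>Terminals and ends of edges all lie in \<open>verts G\<close>, so restricting a
  colouring to \<open>verts G\<close> changes no value that the conditions inspect. This frees later
  witnesses from extensionality.\<close>

lemma formula_iff:
  assumes T: "terminals G \<subseteq> verts G"
    and E: "\<forall>e\<in>edges G. \<exists>u\<in>verts G. \<exists>v\<in>verts G. ends G e = {u, v}"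
  shows "formula G x \<longleftrightarrow>
    (\<exists>s. (\<exists>j\<in>terminals G. s j) \<and> (\<exists>k\<in>terminals G. \<not> s k) \<and> (\<forall>e\<in>edges G. clause G s x e))"
    (is "_ \<longleftrightarrow> ?rhs")
proof
  assume "formula G x"
  then obtain s j k where "j \<in> terminals G" "s j" "k \<in> terminals G" "\<not> s k"
    "\<forall>e\<in>edges G. clause G s x e" by (rule formulaE)
  then show ?rhs by (intro exI[of _ s] conjI bexI)
next
  assume ?rhs
  then obtain s where "(\<exists>j\<in>terminals G. s j) \<and> (\<exists>k\<in>terminals G. \<not> s k) \<and>
    (\<forall>e\<in>edges G. clause G s x e)" ..
  then obtain j k where s: "j \<in> terminals G" "s j" "k \<in> terminals G" "\<not> s k"
    "\<forall>e\<in>edges G. clause G s x e" by (elim conjE bexE)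
  let ?s = "restrict s (verts G)"
  have "clause G ?s x e" if e: "e \<in> edges G" for e
  proof -
    obtain u v where "u \<in> verts G" "v \<in> verts G" "ends G e = {u, v}"
      using bspec[OF E e] by blast
    with bspec[OF s(5) e] show ?thesis by (simp add: clause_iff)
  qed
  moreover have "?s \<in> verts G \<rightarrow>\<^sub>E UNIV" by auto
  moreover have "?s j" "\<not> ?s k" using s T by auto
  ultimately show "formula G x"
    unfolding formula_def using s(1,3)
    by (intro bexI[of _ ?s] conjI ballI bexI[of _ j] bexI[of _ k])
qed

text \<open>A colouring that satisfies all clauses is constant on components of the working
  subgraph, so it cannot separate terminals lying in one component. Conversely, if the terminals are
  not connected, the indicator of the component of one terminal separates it from another.\<close>

lemma formula_iff_not_terminals_connected:
  assumes T: "terminals G \<subseteq> verts G"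
    and E: "\<forall>e\<in>edges G. \<exists>u\<in>verts G. \<exists>v\<in>verts G. ends G e = {u, v}"
  shows "formula G x \<longleftrightarrow> \<not> terminals_connected G {e \<in> edges G. x e}"
proof -
  define R where "R = {(u, v). \<exists>e\<in>{e \<in> edges G. x e}. ends G e = {u, v}}"
  have conn_iff: "terminals_connected G {e \<in> edges G. x e} \<longleftrightarrow> terminals G = {} \<or>
    (\<exists>c\<in>verts G. \<forall>t\<in>terminals G. (c, t) \<in> R\<^sup>*)"
  proof -
    have "connection G {e \<in> edges G. x e} `` {c} = {v \<in> verts G. (c, v) \<in> R\<^sup>*}"
      if "c \<in> verts G" for c
      using that unfolding connection_def R_def by blast
    moreover have "terminals_connected G {e \<in> edges G. x e} \<longleftrightarrow> terminals G = {} \<or>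
      (\<exists>c\<in>verts G. terminals G \<subseteq> connection G {e \<in> edges G. x e} `` {c})"
      unfolding terminals_connected_def components_def quotient_def by simp
    ultimately show ?thesis using T by (simp add: subset_iff Ball_def)
  qed
  show ?thesis
  proof
    assume "formula G x"
    then obtain s j k where s: "j \<in> terminals G" "s j" "k \<in> terminals G" "\<not> s k"
      "\<forall>e\<in>edges G. clause G s x e" by (rule formulaE)
    have const: "s u = s v" if "(u, v) \<in> R\<^sup>*" for u v
      using that
    proof induction
      case (step y z)
      then obtain e where e: "e \<in> edges G" "x e" "ends G e = {y, z}" unfolding R_def by blast
      then have "s y = s z" using bspec[OF s(5) e(1)] by (simp add: clause_iff)
      with step.IH show ?case by simp
    qed simp
    show "\<not> terminals_connected G {e \<in> edges G. x e}"
    proof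
      assume "terminals_connected G {e \<in> edges G. x e}"
      then obtain c where "(c, j) \<in> R\<^sup>*" "(c, k) \<in> R\<^sup>*"
        using s(1,3) unfolding conn_iff by blast
      then show False using const s(2,4) by blast
    qed
  next
    assume nc: "\<not> terminals_connected G {e \<in> edges G. x e}"
    then obtain j where j: "j \<in> terminals G" unfolding conn_iff by blast
    then obtain k where k: "k \<in> terminals G" "(j, k) \<notin> R\<^sup>*"
      using nc T unfolding conn_iff by blast
    let ?s = "\<lambda>v. (j, v) \<in> R\<^sup>*"
    have "clause G ?s x e" if e: "e \<in> edges G" for e
    proof -
      obtain u v where uv: "ends G e = {u, v}" using bspec[OF E e] by blast
      have "?s u = ?s v" if "x e"
      proof -
        \<comment> \<open>Ends form an unordered set, so \<open>R\<close> is symmetric and a working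
          edge cannot leave the set reached from \<open>j\<close>.\<close>
        have "(u, v) \<in> R" "(v, u) \<in> R"
          using e that uv unfolding R_def by (auto simp: insert_commute)
        then show ?thesis by (blast intro: rtrancl_into_rtrancl)
      qed
      then show ?thesis unfolding clause_iff[OF uv] by blast
    qed
    moreover have "?s j" by simp
    ultimately show "formula G x" unfolding formula_iff[OF T E]
      using j k by (intro exI[of _ ?s]) blast
  qed
qed

section \<open>Colourings of a single gadget\<close>

text \<open>The zero-digit edges form a path starting at \<open>v_0\<close>, and each one-digit edge
  jumps from this path to the last vertex. To get across, some one-digit edge \<open>k\<close> must
  work together with all zero-digit edges before it, which lead to its starting point.\<close>

definition gadget_joins :: "nat \<Rightarrow> (nat \<Rightarrow> nat) \<Rightarrow> (nat \<Rightarrow> bool) \<Rightarrow> bool" where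
  "gadget_joins m b y \<longleftrightarrow> (\<exists>k\<in>{1..m}. b k = 1 \<and> y k \<and> (\<forall>j\<in>{1..<k}. b j = 0 \<longrightarrow> y j))"

lemma zeros_0 [simp]: "zeros b 0 = 0"
  by (simp add: zeros_def)

lemma zeros_Suc:
  assumes "\<forall>i\<in>{1..m}. b i \<in> {0, 1}" and "k < m"
  shows "zeros b (Suc k) = (if b (Suc k) = 0 then Suc (zeros b k) else zeros b k)"
proof -
  \<comment> \<open>Digits bounded by 1 keep the natural subtraction in \<open>zeros\<close>
    exact.\<close>
  have "(\<Sum>i=1..k. b i) \<le> (\<Sum>i=1..k. 1)"
  proof (rule sum_mono)
    fix i assume "i \<in> {1..k}"
    with bspec[OF assms(1), of i] assms(2) show "b i \<le> 1" by auto
  qed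
  then have "(\<Sum>i=1..k. b i) \<le> k" by simp
  moreover have "b (Suc k) = 0 \<or> b (Suc k) = 1"
    using bspec[OF assms(1), of "Suc k"] assms(2) by simp
  ultimately show ?thesis by (auto simp: zeros_def Suc_diff_le)
qed

lemma zeros_pred:
  assumes "\<forall>i\<in>{1..m}. b i \<in> {0, 1}" and "k \<in> {1..m}"
  shows "zeros b k = (if b k = 0 then Suc (zeros b (k - 1)) else zeros b (k - 1))"
  using zeros_Suc[OF assms(1), of "k - 1"] assms(2) by auto

lemma zeros_mono:
  assumes "\<forall>i\<in>{1..m}. b i \<in> {0, 1}" and "j \<le> k" and "k \<le> m"
  shows "zeros b j \<le> zeros b k"
  using assms(2,3)
proof (induction k rule: dec_induct)
  case (step n)
  have "zeros b n \<le> zeros b (Suc n)"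
    using zeros_Suc[OF assms(1), of n] step.prems by simp
  moreover have "zeros b j \<le> zeros b n" using step.IH step.prems by simp
  ultimately show ?case by simp
qed simp

text \<open>Here \<open>t i\<close> is the colour of \<open>v_i\<close>, with colours
  \<open>a\<close> and \<open>c\<close> prescribed at the two terminal vertices. If the gadget joins
  them, the colour propagates along the working path; otherwise the part of the path reachable from
  \<open>v_0\<close> can take colour \<open>a\<close> and everything else colour
  \<open>c\<close>.\<close>

lemma gadget_colouring_iff:
  assumes b: "\<forall>i\<in>{1..m}. b i \<in> {0, 1}"
  shows "(\<exists>t. t 0 = a \<and> t (Suc (zeros b m)) = c \<and>
      (\<forall>k\<in>{1..m}. y k \<longrightarrow> t (zeros b (k - 1)) =
        (if b k = 0 then t (zeros b k) else t (Suc (zeros b m))))) \<longleftrightarrow>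
    (gadget_joins m b y \<longrightarrow> a = c)" (is "(\<exists>t. ?col t) \<longleftrightarrow> _")
proof
  assume "\<exists>t. ?col t"
  then obtain t where t: "t 0 = a" "t (Suc (zeros b m)) = c"
    "\<And>k. k \<in> {1..m} \<Longrightarrow> y k \<Longrightarrow> t (zeros b (k - 1)) =
        (if b k = 0 then t (zeros b k) else t (Suc (zeros b m)))" by blast
  show "gadget_joins m b y \<longrightarrow> a = c"
  proof
    assume "gadget_joins m b y"
    then obtain k where k: "k \<in> {1..m}" "b k = 1" "y k" "\<forall>j\<in>{1..<k}. b j = 0 \<longrightarrow> y j"
      by (auto simp: gadget_joins_def)
    \<comment> \<open>A zero digit moves one vertex along a working edge of the path; a one digit
      leaves \<open>zeros\<close> unchanged. Either way the colour persists.\<close>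
    have "t (zeros b j) = a" if "j < k" for j
      using that
    proof (induction j)
      case (Suc j)
      then have "Suc j \<in> {1..m}" "j < m" using k(1) by auto
      with Suc t(3)[of "Suc j"] k(4) zeros_Suc[OF b, of j] show ?case by auto
    qed (simp add: t(1))
    from this[of "k - 1"] have "t (zeros b (k - 1)) = a" using k(1) by auto
    with t(2) t(3)[OF k(1,3)] k(2) show "a = c" by simp
  qed
next
  assume imp: "gadget_joins m b y \<longrightarrow> a = c"
  show "\<exists>t. ?col t"
  proof (cases "a = c")
    case True
    then show ?thesis by (intro exI[of _ "\<lambda>_. a"]) simp
  next
    case False
    with imp have nj: "\<not> gadget_joins m b y" by blast
    \<comment> \<open>\<open>v\<^sub>i\<close> keeps the colour of \<open>v\<^sub>0\<close> as long as the path from \<open>v\<^sub>0\<close> to \<open>v\<^sub>i\<close> works.\<close>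
    define t where "t i = (if i \<noteq> Suc (zeros b m) \<and>
      (\<forall>j\<in>{1..m}. b j = 0 \<and> zeros b j \<le> i \<longrightarrow> y j) then a else c)" for i
    have le: "zeros b k \<le> zeros b m" if "k \<le> m" for k
      using zeros_mono[OF b that] by simp
    \<comment> \<open>This makes the path condition vacuous at \<open>i = 0\<close>, giving
      \<open>t 0 = a\<close>.\<close>
    have pos: "zeros b j > 0" if "j \<in> {1..m}" "b j = 0" for j
      using zeros_pred[OF b that(1)] that(2) by simp
    have "t (zeros b (k - 1)) = (if b k = 0 then t (zeros b k) else t (Suc (zeros b m)))"
      if k: "k \<in> {1..m}" "y k" for k
    proof (cases "b k = 0")
      case True
      have zk: "zeros b k = Suc (zeros b (k - 1))" using zeros_pred[OF b k(1)] True by simp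
      \<comment> \<open>Raising the threshold from \<open>zeros b (k - 1)\<close> to
        \<open>zeros b k\<close> admits only the zero-digit edge \<open>k\<close> itself, and that
        edge works.\<close>
      have "(\<forall>j\<in>{1..m}. b j = 0 \<and> zeros b j \<le> zeros b (k - 1) \<longrightarrow> y j) \<longleftrightarrow>
        (\<forall>j\<in>{1..m}. b j = 0 \<and> zeros b j \<le> zeros b k \<longrightarrow> y j)"
      proof (intro ball_cong refl)
        fix j assume j: "j \<in> {1..m}"
        consider "j < k" | "j = k" | "k < j" by linarith
        then show "(b j = 0 \<and> zeros b j \<le> zeros b (k - 1) \<longrightarrow> y j) \<longleftrightarrow>
          (b j = 0 \<and> zeros b j \<le> zeros b k \<longrightarrow> y j)"
        proof cases
          case 1
          have "j \<le> k - 1" "k - 1 \<le> m" using 1 k(1) by auto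
          then have "zeros b j \<le> zeros b (k - 1)" by (rule zeros_mono[OF b])
          then show ?thesis using zk by simp
        next
          case 2
          then show ?thesis using k by simp
        next
          case 3
          then have "zeros b k \<le> zeros b (j - 1)" using zeros_mono[OF b, of k "j - 1"] j by auto
          then show ?thesis using zeros_pred[OF b j] zk by auto
        qed
      qed
      moreover have "zeros b k \<noteq> Suc (zeros b m)" "zeros b (k - 1) \<noteq> Suc (zeros b m)"
        using le[of k] k(1) zk by auto
      ultimately have "t (zeros b (k - 1)) = t (zeros b k)" by (simp add: t_def)
      then show ?thesis using True by simp
    next
      case False
      then have "b k = 1" using bspec[OF b k(1)] by simp
      \<comment> \<open>Since the one-digit edge \<open>k\<close> works but the gadget does not
        join, the path must be broken before \<open>k\<close>; hence the start of edge
        \<open>k\<close> already has colour \<open>c\<close>.\<close>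
      then obtain j where j: "j \<in> {1..<k}" "b j = 0" "\<not> y j"
        using nj k by (auto simp: gadget_joins_def)
      moreover have "zeros b j \<le> zeros b (k - 1)" using zeros_mono[OF b, of j "k - 1"] j k by auto
      moreover have "j \<in> {1..m}" using j k by auto
      ultimately have "t (zeros b (k - 1)) = c" unfolding t_def by metis
      then show ?thesis using False by (simp add: t_def)
    qed
    moreover have "t 0 = a" using pos by (fastforce simp: t_def)
    moreover have "t (Suc (zeros b m)) = c" by (simp add: t_def)
    ultimately show ?thesis by blast
  qed
qed

section \<open>From the gadget graph back to the original graph\<close>

lemma gadget_ends_subset_verts:
  assumes G: "finite_graph G"
    and b: "\<forall>k\<in>{1..m e}. b e k \<in> {0, 1}"
    and e: "e \<in> edges G" "ends G e = {src e, tgt e}"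
    and k: "k \<in> {1..m e}"
  shows "gadget_ends e (src e) (tgt e) (m e) (b e) k \<subseteq> verts (gadget_graph G src tgt m b)"
proof -
  have "src e \<in> verts G" "tgt e \<in> verts G"
    using G e by (force simp: finite_graph_def doubleton_eq_iff)+
  then have "gadget_vert e (src e) (tgt e) (zeros (b e) (m e)) i
      \<in> verts (gadget_graph G src tgt m b)" if "i \<le> Suc (zeros (b e) (m e))" for i
    using that e(1) by (auto simp: gadget_vert_def gadget_graph_def)
  moreover have "zeros (b e) i \<le> zeros (b e) (m e)" if "i \<le> m e" for i
    using zeros_mono[where m = "m e" and b = "b e", OF b that] by simp
  ultimately show ?thesis using k by (auto simp: gadget_ends_def Let_def le_Suc_eq)
qed

text \<open>A separating colouring of the gadget graph restricts to the original vertices. In the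
  other direction, the inner vertices of a gadget are private to it, so extensions chosen for each
  gadget separately fit together.\<close>

lemma formula_gadget_graph:
  assumes G: "finite_graph G"
    and b: "\<forall>e\<in>edges G. \<forall>k\<in>{1..m e}. b e k \<in> {0, 1}"
    and ends: "\<forall>e\<in>edges G. ends G e = {src e, tgt e}"
  shows "formula (gadget_graph G src tgt m b) x \<longleftrightarrow>
    formula G (\<lambda>e. gadget_joins (m e) (b e) (\<lambda>k. x (e, k)))"
proof -
  let ?G' = "gadget_graph G src tgt m b"
  let ?w = "\<lambda>e. gadget_joins (m e) (b e) (\<lambda>k. x (e, k))"
  let ?n = "\<lambda>e. zeros (b e) (m e)"
  let ?vert = "\<lambda>e. gadget_vert e (src e) (tgt e) (?n e)"
  have T: "terminals G \<subseteq> verts G" using G by (simp add: finite_graph_def)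
  have E: "\<forall>e\<in>edges G. \<exists>u\<in>verts G. \<exists>v\<in>verts G. ends G e = {u, v}"
    using G by (simp add: finite_graph_def)
  have T': "terminals ?G' \<subseteq> verts ?G'" using T by (auto simp: gadget_graph_def)
  have ends': "ends ?G' (e, k) = {?vert e (zeros (b e) (k - 1)),
      if b e k = 0 then ?vert e (zeros (b e) k) else ?vert e (Suc (?n e))}" for e k
    by (simp add: gadget_graph_def gadget_ends_def Let_def)
  have E': "\<forall>e\<in>edges ?G'. \<exists>u\<in>verts ?G'. \<exists>v\<in>verts ?G'. ends ?G' e = {u, v}"
  proof
    fix ek assume "ek \<in> edges ?G'"
    then obtain e k where ek: "ek = (e, k)" "e \<in> edges G" "k \<in> {1..m e}"
      by (auto simp: gadget_graph_def)
    have "ends ?G' (e, k) \<subseteq> verts ?G'"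
      using gadget_ends_subset_verts[where src = src and tgt = tgt and m = m and b = b,
          OF G bspec[OF b ek(2)] ek(2) bspec[OF ends ek(2)] ek(3)]
      by (simp add: gadget_graph_def)
    then show "\<exists>u\<in>verts ?G'. \<exists>v\<in>verts ?G'. ends ?G' ek = {u, v}"
      unfolding ek(1) ends' by blast
  qed
  have clauses: "(\<forall>e\<in>edges ?G'. clause ?G' s x e) \<longleftrightarrow> (\<forall>e\<in>edges G. \<forall>k\<in>{1..m e}. x (e, k) \<longrightarrow>
      s (?vert e (zeros (b e) (k - 1))) =
      (if b e k = 0 then s (?vert e (zeros (b e) k)) else s (?vert e (Suc (?n e)))))" for s
  proof -
    have "(\<forall>e\<in>edges ?G'. clause ?G' s x e) \<longleftrightarrow>
        (\<forall>e\<in>edges G. \<forall>k\<in>{1..m e}. clause ?G' s x (e, k))"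
      by (auto simp: gadget_graph_def)
    then show ?thesis unfolding clause_iff[OF ends'] if_distrib[where f = s] .
  qed
  show ?thesis
  proof
    assume "formula ?G' x"
    then obtain s j k where s: "j \<in> terminals ?G'" "s j" "k \<in> terminals ?G'" "\<not> s k"
      "\<forall>e\<in>edges ?G'. clause ?G' s x e" by (rule formulaE)
    have "clause G (s \<circ> Orig) ?w e" if e: "e \<in> edges G" for e
      unfolding clause_iff[OF bspec[OF ends e]] o_def
    proof (rule iffD1[OF gadget_colouring_iff[OF bspec[OF b e]]])
      let ?t = "\<lambda>i. s (?vert e i)"
      have "?t 0 = s (Orig (src e))" "?t (Suc (?n e)) = s (Orig (tgt e))"
        by (simp_all add: gadget_vert_def)
      moreover have "\<forall>k\<in>{1..m e}. x (e, k) \<longrightarrow> ?t (zeros (b e) (k - 1)) =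
        (if b e k = 0 then ?t (zeros (b e) k) else ?t (Suc (?n e)))"
        using s(5)[unfolded clauses] e by blast
      ultimately show "\<exists>t. t 0 = s (Orig (src e)) \<and> t (Suc (?n e)) = s (Orig (tgt e)) \<and>
        (\<forall>k\<in>{1..m e}. x (e, k) \<longrightarrow> t (zeros (b e) (k - 1)) =
          (if b e k = 0 then t (zeros (b e) k) else t (Suc (?n e))))"
        by (intro exI[of _ ?t] conjI)
    qed
    then have "\<forall>e\<in>edges G. clause G (s \<circ> Orig) ?w e" by (rule ballI)
    moreover obtain j' k' where "j = Orig j'" "k = Orig k'" "j' \<in> terminals G" "k' \<in> terminals G"
      using s(1,3) by (auto simp: gadget_graph_def)
    ultimately show "formula G ?w"
      unfolding formula_iff[OF T E] using s(2,4) by (intro exI[of _ "s \<circ> Orig"]) auto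
  next
    assume "formula G ?w"
    then obtain s j k where s: "j \<in> terminals G" "s j" "k \<in> terminals G" "\<not> s k"
      "\<forall>e\<in>edges G. clause G s ?w e" by (rule formulaE)
    have "\<forall>e\<in>edges G. \<exists>t. t 0 = s (src e) \<and> t (Suc (?n e)) = s (tgt e) \<and>
      (\<forall>k\<in>{1..m e}. x (e, k) \<longrightarrow> t (zeros (b e) (k - 1)) =
        (if b e k = 0 then t (zeros (b e) k) else t (Suc (?n e))))"
    proof
      fix e assume e: "e \<in> edges G"
      have "?w e \<longrightarrow> s (src e) = s (tgt e)"
        using bspec[OF s(5) e] unfolding clause_iff[OF bspec[OF ends e]] .
      from gadget_colouring_iff[THEN iffD2, OF bspec[OF b e] this]
      show "\<exists>t. t 0 = s (src e) \<and> t (Suc (?n e)) = s (tgt e) \<and>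
      (\<forall>k\<in>{1..m e}. x (e, k) \<longrightarrow> t (zeros (b e) (k - 1)) =
        (if b e k = 0 then t (zeros (b e) k) else t (Suc (?n e))))" .
    qed
    from bchoice[OF this] obtain t where t: "\<And>e. e \<in> edges G \<Longrightarrow> t e 0 = s (src e)"
      "\<And>e. e \<in> edges G \<Longrightarrow> t e (Suc (?n e)) = s (tgt e)"
      "\<And>e k. e \<in> edges G \<Longrightarrow> k \<in> {1..m e} \<Longrightarrow> x (e, k) \<Longrightarrow> t e (zeros (b e) (k - 1)) =
        (if b e k = 0 then t e (zeros (b e) k) else t e (Suc (?n e)))" by blast
    define s' where "s' v = (case v of Orig u \<Rightarrow> s u | New e i \<Rightarrow> t e i)" for v
    \<comment> \<open>Indices \<open>0\<close> and \<open>Suc (?n e)\<close> denote original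
      vertices, where the prescribed end colours of \<open>t e\<close> agree with \<open>s\<close>;
      every other index is a \<open>New\<close> vertex.\<close>
    have "s' (?vert e i) = t e i" if "e \<in> edges G" for e i
      using t(1,2)[OF that] by (auto simp: s'_def gadget_vert_def)
    then have "\<forall>e\<in>edges ?G'. clause ?G' s' x e"
      unfolding clauses using t(3) by (intro ballI) presburger
    moreover have "Orig j \<in> terminals ?G'" "Orig k \<in> terminals ?G'" "s' (Orig j)" "\<not> s' (Orig k)"
      using s(1-4) by (auto simp: gadget_graph_def s'_def)
    ultimately show "formula ?G' x"
      unfolding formula_iff[OF T' E'] by (intro exI[of _ s'] conjI bexI)
  qed
qed

section \<open>Counting the joining states of a gadget\<close>

text \<open>For the least admissible \<open>k\<close>, no earlier one-digit edge works. With
  \<open>1 - y j\<close> read as a digit, \<open>k\<close> is then the first position where the two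
  binary numbers differ, so \<open>k\<close> is unique.\<close>

lemma gadget_joins_iff_first_difference:
  assumes "\<forall>i\<in>{1..m}. b i \<in> {0, 1}"
  shows "gadget_joins m b y \<longleftrightarrow>
    (\<exists>k\<in>{1..m}. b k = 1 \<and> y k \<and> (\<forall>j\<in>{1..<k}. y j \<longleftrightarrow> b j = 0))"
proof
  assume "gadget_joins m b y"
  then have ex: "\<exists>k. k \<in> {1..m} \<and> b k = 1 \<and> y k \<and> (\<forall>j\<in>{1..<k}. b j = 0 \<longrightarrow> y j)" (is "\<exists>k. ?P k")
    by (auto simp: gadget_joins_def)
  define k where "k = (LEAST k. ?P k)"
  have k: "?P k" unfolding k_def by (rule LeastI_ex[OF ex])
  have "b j = 0" if "j \<in> {1..<k}" "y j" for j
  proof (rule ccontr)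
    assume "b j \<noteq> 0"
    then have "?P j" using bspec[OF assms, of j] that k by auto
    then have "k \<le> j" unfolding k_def by (rule Least_le)
    then show False using that by simp
  qed
  then show "\<exists>k\<in>{1..m}. b k = 1 \<and> y k \<and> (\<forall>j\<in>{1..<k}. y j \<longleftrightarrow> b j = 0)" using k by blast
qed (auto simp: gadget_joins_def)

lemma card_gadget_joins:
  assumes b: "\<forall>i\<in>{1..m}. b i \<in> {0, 1}"
  shows "real (card {y \<in> {1..m} \<rightarrow>\<^sub>E UNIV. gadget_joins m b y}) =
    2 ^ m * (\<Sum>k=1..m. real (b k) / 2 ^ k)"
proof -
  \<comment> \<open>States whose first difference is at \<open>k\<close>: coordinates up to
    \<open>k\<close> are fixed, and the remaining \<open>m - k\<close> are free, which gives
    \<open>2 ^ (m - k)\<close> states.\<close>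
  define D where "D k = (\<Pi>\<^sub>E j\<in>{1..m}. if j < k then {b j = 0} else if j = k then {True} else UNIV)"
    for k
  let ?K = "{k \<in> {1..m}. b k = 1}"
  have "{y \<in> {1..m} \<rightarrow>\<^sub>E UNIV. gadget_joins m b y} = (\<Union>k\<in>?K. D k)"
  proof (intro set_eqI iffI)
    fix y assume "y \<in> {y \<in> {1..m} \<rightarrow>\<^sub>E UNIV. gadget_joins m b y}"
    then have y: "y \<in> {1..m} \<rightarrow>\<^sub>E UNIV" "gadget_joins m b y" by auto
    then obtain k where k: "k \<in> ?K" "y k" "\<forall>j\<in>{1..<k}. y j \<longleftrightarrow> b j = 0"
      unfolding gadget_joins_iff_first_difference[OF b] by blast
    have "y \<in> D k" unfolding D_def
    proof (rule PiE_I)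
      fix j assume "j \<in> {1..m}"
      then show "y j \<in> (if j < k then {b j = 0} else if j = k then {True} else UNIV)"
        using k by auto
    qed (use y(1) in auto)
    then show "y \<in> (\<Union>k\<in>?K. D k)" using k(1) by blast
  next
    fix y assume "y \<in> (\<Union>k\<in>?K. D k)"
    then obtain k where k: "k \<in> ?K" "y \<in> D k" by blast
    have mem: "y j \<in> (if j < k then {b j = 0} else if j = k then {True} else UNIV)"
      if "j \<in> {1..m}" for j
      using k(2) that unfolding D_def by (rule PiE_mem)
    have "y j \<longleftrightarrow> b j = 0" if "j \<in> {1..<k}" for j
      using mem[of j] that k(1) by auto
    moreover have "y k" using mem[of k] k(1) by auto
    ultimately have "gadget_joins m b y"
      using k(1) unfolding gadget_joins_def by blast
    moreover have "y \<in> {1..m} \<rightarrow>\<^sub>E UNIV" using k(2) by (auto simp: D_def PiE_def)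
    ultimately show "y \<in> {y \<in> {1..m} \<rightarrow>\<^sub>E UNIV. gadget_joins m b y}" by simp
  qed
  moreover have "D k \<inter> D l = {}" if "k \<in> ?K" "l \<in> ?K" "k < l" for k l
  proof -
    \<comment> \<open>At coordinate \<open>k\<close>, membership in \<open>D k\<close> forces
      \<open>True\<close>, while \<open>D l\<close> forces the value of \<open>b k = 0\<close>,
      which is \<open>False\<close>.\<close>
    have False if y: "y \<in> D k" "y \<in> D l" for y
    proof -
      have "k \<in> {1..m}" "b k = 1" using \<open>k \<in> ?K\<close> by auto
      then show False
        using PiE_mem[OF y(1)[unfolded D_def], of k] PiE_mem[OF y(2)[unfolded D_def], of k]
          \<open>k < l\<close> by simp
    qed
    then show ?thesis by blast
  qed
  then have "D k \<inter> D l = {}" if "k \<in> ?K" "l \<in> ?K" "k \<noteq> l" for k l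
    using that(3) that(1,2) by (elim linorder_neqE_nat) (blast, subst Int_commute, blast)
  moreover have "finite (D k)" for k unfolding D_def by (intro finite_PiE) auto
  ultimately have "card {y \<in> {1..m} \<rightarrow>\<^sub>E UNIV. gadget_joins m b y} = (\<Sum>k\<in>?K. card (D k))"
    by (simp add: card_UN_disjoint)
  also have "\<dots> = (\<Sum>k\<in>?K. 2 ^ (m - k))"
  proof (rule sum.cong[OF refl])
    fix k assume "k \<in> ?K"
    have "card (D k) = (\<Prod>j\<in>{1..m}. if k < j then 2 else 1)"
      unfolding D_def by (subst card_PiE) (auto intro!: prod.cong)
    also have "\<dots> = 2 ^ card ({1..m} \<inter> {j. k < j})"
      by (simp add: prod.If_cases)
    also have "{1..m} \<inter> {j. k < j} = {k<..m}" by auto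
    finally show "card (D k) = 2 ^ (m - k)" by simp
  qed
  finally have "real (card {y \<in> {1..m} \<rightarrow>\<^sub>E UNIV. gadget_joins m b y}) = (\<Sum>k\<in>?K. 2 ^ (m - k))"
    by simp
  also have "\<dots> = (\<Sum>k=1..m. if b k = 1 then 2 ^ (m - k) else 0)"
    by (rule sum.inter_filter) simp
  \<comment> \<open>Because digits are 0 or 1, the indicator of \<open>b k = 1\<close> is the factor
    \<open>real (b k)\<close>.\<close>
  also have "\<dots> = (\<Sum>k=1..m. 2 ^ m * (real (b k) / 2 ^ k))"
    using b by (intro sum.cong refl) (auto simp: power_diff)
  finally show ?thesis by (simp add: sum_distrib_left)
qed

text \<open>The non-joining states are counted by complement. Treating both outcomes through
  \<open>c\<close> lets the count over a state of the original graph be a single product.\<close>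

lemma card_gadget_joins_eq:
  assumes b: "\<forall>i\<in>{1..m}. b i \<in> {0, 1}"
    and q: "q = (\<Sum>k=1..m. real (b k) / 2 ^ k)" "0 \<le> q" "q \<le> 1"
  shows "real (card {y \<in> {1..m} \<rightarrow>\<^sub>E UNIV. gadget_joins m b y = c}) =
    2 ^ m * pmf (bernoulli_pmf q) c"
proof -
  let ?A = "{1..m} \<rightarrow>\<^sub>E (UNIV :: bool set)"
  have true: "real (card {y \<in> ?A. gadget_joins m b y}) = 2 ^ m * q"
    using card_gadget_joins[OF b] q(1) by simp
  have fin: "finite ?A" by (intro finite_PiE) auto
  have "card {y \<in> ?A. gadget_joins m b y} + card {y \<in> ?A. \<not> gadget_joins m b y} = card ?A"
    using fin by (subst card_Un_disjoint[symmetric]) (auto intro!: arg_cong[where f = card])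
  also have "card ?A = 2 ^ m" by (simp add: card_PiE)
  finally have "real (card {y \<in> ?A. gadget_joins m b y} + card {y \<in> ?A. \<not> gadget_joins m b y}) =
    real (2 ^ m)" by (rule arg_cong)
  then have "real (card {y \<in> ?A. \<not> gadget_joins m b y}) = 2 ^ m - 2 ^ m * q"
    unfolding of_nat_add true by simp
  then show ?thesis using true q by (cases c) (simp_all add: algebra_simps)
qed

section \<open>Summation over the states of the original graph\<close>

text \<open>Currying turns functions on a dependent sum into families of functions, and conditions
  on separate members of a family multiply. Both directions use \<open>restrict\<close>, so that
  values outside the domains match the extensional convention.\<close>

lemma card_PiE_Sigma:
  assumes "finite A"
  shows "card {x \<in> Sigma A B \<rightarrow>\<^sub>E UNIV. \<forall>a\<in>A. P a (restrict (\<lambda>k. x (a, k)) (B a))} =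
    (\<Prod>a\<in>A. card {y \<in> B a \<rightarrow>\<^sub>E UNIV. P a y})"
proof -
  let ?X = "{x \<in> Sigma A B \<rightarrow>\<^sub>E UNIV. \<forall>a\<in>A. P a (restrict (\<lambda>k. x (a, k)) (B a))}"
  let ?Y = "\<Pi>\<^sub>E a\<in>A. {y \<in> B a \<rightarrow>\<^sub>E UNIV. P a y}"
  let ?f = "\<lambda>x. \<lambda>a\<in>A. \<lambda>k\<in>B a. x (a, k)"
  let ?g = "\<lambda>z. \<lambda>(a, k)\<in>Sigma A B. z a k"
  have "bij_betw ?f ?X ?Y"
  proof (rule bij_betw_byWitness[where f' = ?g])
    show "\<forall>x\<in>?X. ?g (?f x) = x"
    proof
      fix x assume "x \<in> ?X"
      then have "x \<in> extensional (Sigma A B)" by (auto simp: PiE_def)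
      then show "?g (?f x) = x" by (auto simp: fun_eq_iff restrict_def extensional_def)
    qed
    have restr: "(\<lambda>k\<in>B a. ?g z (a, k)) = z a" if "z \<in> ?Y" "a \<in> A" for z a
    proof -
      have "z a \<in> B a \<rightarrow>\<^sub>E UNIV" using PiE_mem[OF that] by blast
      then have "restrict (z a) (B a) = z a" by (rule PiE_restrict)
      moreover have "(\<lambda>k\<in>B a. ?g z (a, k)) = restrict (z a) (B a)"
        using that(2) by (intro restrict_ext) simp
      ultimately show ?thesis by simp
    qed
    show "\<forall>z\<in>?Y. ?f (?g z) = z"
    proof
      fix z assume z: "z \<in> ?Y"
      show "?f (?g z) = z"
      proof
        fix a show "?f (?g z) a = z a"
        proof (cases "a \<in> A")
          case True
          then have "?f (?g z) a = (\<lambda>k\<in>B a. ?g z (a, k))" by (rule restrict_apply')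
          also have "\<dots> = z a" by (rule restr[OF z True])
          finally show ?thesis .
        next
          case False
          then show ?thesis using PiE_arb[OF z False] by simp
        qed
      qed
    qed
    show "?f ` ?X \<subseteq> ?Y" by auto
    show "?g ` ?Y \<subseteq> ?X"
    proof (intro image_subsetI CollectI conjI ballI)
      fix z assume z: "z \<in> ?Y"
      show "?g z \<in> Sigma A B \<rightarrow>\<^sub>E UNIV" by auto
      fix a assume a: "a \<in> A"
      show "P a (\<lambda>k\<in>B a. ?g z (a, k))"
        unfolding restr[OF z a] using PiE_mem[OF z a] by blast
    qed
  qed
  then have "card ?X = card ?Y" by (rule bij_betw_same_card)
  then show ?thesis by (simp add: card_PiE assms)
qed

theorem theorem3:
  fixes G :: "('v, 'e) graph"
    and p :: "'e \<Rightarrow> real"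
    and m :: "'e \<Rightarrow> nat"
    and b :: "'e \<Rightarrow> nat \<Rightarrow> nat"
    and src tgt :: "'e \<Rightarrow> 'v"
  assumes "finite_graph G"
    and "\<And>e. e \<in> edges G \<Longrightarrow> 0 < p e \<and> p e < 1"
    and "\<And>e k. e \<in> edges G \<Longrightarrow> k \<in> {1..m e} \<Longrightarrow> b e k \<in> {0, 1}"
    and "\<And>e. e \<in> edges G \<Longrightarrow> 1 - p e = (\<Sum>k=1..m e. real (b e k) / 2 ^ k)"
    and "\<And>e. e \<in> edges G \<Longrightarrow> ends G e = {src e, tgt e}"
  shows "let G' = gadget_graph G src tgt m b;
             M = (\<Sum>e\<in>edges G. m e)
         in M = card (edges G') \<and>
            unreliability G p = real (model_count G') / 2 ^ M"
proof -
  let ?G' = "gadget_graph G src tgt m b"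
  let ?M = "\<Sum>e\<in>edges G. m e"
  let ?joins = "\<lambda>x e. gadget_joins (m e) (b e) (\<lambda>k. x (e, k))"
  have fin: "finite (edges G)" and T: "terminals G \<subseteq> verts G"
    using assms(1) by (simp_all add: finite_graph_def)
  have E: "\<forall>e\<in>edges G. \<exists>u\<in>verts G. \<exists>v\<in>verts G. ends G e = {u, v}"
    using assms(1) by (simp add: finite_graph_def)
  have b: "\<forall>e\<in>edges G. \<forall>k\<in>{1..m e}. b e k \<in> {0, 1}"
    and ends: "\<forall>e\<in>edges G. ends G e = {src e, tgt e}" using assms(3,5) by blast+
  have edges': "edges ?G' = (SIGMA e:edges G. {1..m e})" by (simp add: gadget_graph_def)
  \<comment> \<open>The value \<open>False\<close> off the edges matches the default of
    \<open>Pi_pmf\<close>. It makes \<open>A\<close> finite and each \<open>w\<close> in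
    \<open>A\<close> determined by its values on the edges.\<close>
  define A where "A = {w. (\<forall>e. w e \<longrightarrow> e \<in> edges G) \<and> formula G w}"
  \<comment> \<open>Gadget states that induce the state \<open>w\<close> on the original edges;
    their share among all \<open>2 ^ ?M\<close> states will be the probability of
    \<open>w\<close>.\<close>
  define fibre where "fibre w = {x \<in> edges ?G' \<rightarrow>\<^sub>E UNIV. \<forall>e\<in>edges G. ?joins x e = w e}" for w
  let ?pmf = "Pi_pmf (edges G) False (\<lambda>e. bernoulli_pmf (1 - p e))"
  have finA: "finite A"
  proof (rule finite_subset)
    show "A \<subseteq> (\<lambda>S e. e \<in> S) ` Pow (edges G)"
    proof
      fix w assume "w \<in> A"
      then have "w = (\<lambda>e. e \<in> {e. w e})" "{e. w e} \<in> Pow (edges G)" by (auto simp: A_def)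
      then show "w \<in> (\<lambda>S e. e \<in> S) ` Pow (edges G)" by (rule image_eqI)
    qed
  qed (simp add: fin)
  have fin_fibre: "finite (fibre w)" for w
    unfolding fibre_def edges' using fin
    by (intro finite_subset[OF _ finite_PiE[of "SIGMA e:edges G. {1..m e}" "\<lambda>_. UNIV :: bool set"]]) auto
  have formula_cong: "formula G w \<longleftrightarrow> formula G w'" if "\<And>e. e \<in> edges G \<Longrightarrow> w e = w' e" for w w'
    using that by (auto simp: formula_def clause_def)

  have card_fibre: "real (card (fibre w)) = 2 ^ ?M * pmf ?pmf w" if "w \<in> A" for w
  proof -
    \<comment> \<open>This removes the \<open>restrict\<close> that currying introduces.\<close>
    have "gadget_joins (m e) (b e) (restrict y {1..m e}) = gadget_joins (m e) (b e) y" for e y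
      by (auto simp: gadget_joins_def)
    then have "card (fibre w) =
        (\<Prod>e\<in>edges G. card {y \<in> {1..m e} \<rightarrow>\<^sub>E UNIV. gadget_joins (m e) (b e) y = w e})"
      unfolding fibre_def edges' by (subst card_PiE_Sigma[OF fin, symmetric]) simp
    then have "real (card (fibre w)) =
        (\<Prod>e\<in>edges G. 2 ^ m e * pmf (bernoulli_pmf (1 - p e)) (w e))"
      unfolding \<open>card (fibre w) = _\<close> of_nat_prod
    proof (intro prod.cong refl card_gadget_joins_eq)
      fix e assume e: "e \<in> edges G"
      show "\<forall>k\<in>{1..m e}. b e k \<in> {0, 1}" using b e by blast
      show "1 - p e = (\<Sum>k=1..m e. real (b e k) / 2 ^ k)" by (rule assms(4)[OF e])
      show "0 \<le> 1 - p e" "1 - p e \<le> 1" using assms(2)[OF e] by auto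
    qed
    also have "\<dots> = 2 ^ ?M * pmf ?pmf w"
      using that by (subst pmf_Pi'[OF fin]) (auto simp: A_def prod.distrib power_sum)
    finally show ?thesis .
  qed

  have "{x \<in> edges ?G' \<rightarrow>\<^sub>E UNIV. formula ?G' x} = (\<Union>w\<in>A. fibre w)"
  proof (intro set_eqI iffI)
    fix x assume "x \<in> {x \<in> edges ?G' \<rightarrow>\<^sub>E UNIV. formula ?G' x}"
    then have x: "x \<in> edges ?G' \<rightarrow>\<^sub>E UNIV" "formula G (?joins x)"
      using formula_gadget_graph[OF assms(1) b ends, where x = x] by auto
    let ?w = "\<lambda>e. e \<in> edges G \<and> ?joins x e"
    have "?w \<in> A" using x(2) formula_cong[of "?joins x" ?w] by (simp add: A_def)
    moreover have "x \<in> fibre ?w" using x(1) by (simp add: fibre_def)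
    ultimately show "x \<in> (\<Union>w\<in>A. fibre w)" by blast
  next
    fix x assume "x \<in> (\<Union>w\<in>A. fibre w)"
    then obtain w where "w \<in> A" "x \<in> fibre w" by blast
    then show "x \<in> {x \<in> edges ?G' \<rightarrow>\<^sub>E UNIV. formula ?G' x}"
      using formula_gadget_graph[OF assms(1) b ends, where x = x] formula_cong[of "?joins x" w]
      by (simp add: A_def fibre_def)
  qed
  \<comment> \<open>Distinct members of \<open>A\<close> must differ at an edge of \<open>G\<close>,
    where a common \<open>x\<close> would induce two different values.\<close>
  moreover have "fibre w \<inter> fibre w' = {}" if "w \<in> A" "w' \<in> A" "w \<noteq> w'" for w w'
    using that by (fastforce simp: A_def fibre_def)
  ultimately have "model_count ?G' = (\<Sum>w\<in>A. card (fibre w))"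
    unfolding model_count_def using finA fin_fibre by (simp add: card_UN_disjoint)
  then have "real (model_count ?G') = 2 ^ ?M * (\<Sum>w\<in>A. pmf ?pmf w)"
    using card_fibre by (simp add: sum_distrib_left)
  moreover have "unreliability G p = (\<Sum>w\<in>A. pmf ?pmf w)"
  proof -
    have "unreliability G p = measure_pmf.prob ?pmf {w. formula G w}"
      unfolding unreliability_def formula_iff_not_terminals_connected[OF T E] ..
    also have "\<dots> = measure_pmf.prob ?pmf A"
    \<comment> \<open>States that are true somewhere off the edges have probability 0, so cutting
      down to the finite set \<open>A\<close> loses nothing.\<close>
    proof (rule measure_prob_cong_0)
      fix w assume "w \<in> {w. formula G w} - A"
      then show "pmf ?pmf w = 0" by (auto simp: A_def intro!: pmf_Pi_outside[OF fin])
    qed (auto simp: A_def)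
    also have "\<dots> = (\<Sum>w\<in>A. pmf ?pmf w)"
      by (rule measure_measure_pmf_finite[OF finA])
    finally show ?thesis .
  qed
  moreover have "?M = card (edges ?G')"
    unfolding edges' using fin by simp
  ultimately show ?thesis by (simp add: Let_def)
qed

end
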